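(* 1) Let $(y,z,A)\in V_n$ and let $D$ be any invertible diagonal complex $n\times n$ matrix. Then $(Dy,Dz,DAD^{-3})\in V_n$. 2) Let $(y,z,A)\in W_n$ and let $D$ be any invertible diagonal complex $n\times n$ matrix. Then $(D^3y,Dz,DAD^{-3})\in W_n$.
   Context: For $u,v\in\mathbb{C}^n$, $u*v=(u_1v_1,\ldots,u_nv_n)$ is the coordinatewise product, $u^k$ is the coordinatewise $k$-th power, and $\Delta[u]$ is the diagonal $n\times n$ matrix with $(i,i)$ entry $u_i$. $\mathcal{M}_n$ is the set of complex $n\times n$ matrices. Define $$V_n=\{(y,z,A)\in\mathbb{C}^n\times\mathbb{C}^n\times\mathcal{M}_n:\ \det(Id+\Delta[(sz+ty)^2].A)=1\ \forall s,t\in\mathbb{C},\ z+A.(z^3+z*y^2)=0\},$$ $$W_n=\{(y,z,A)\in\mathbb{C}^n\times\mathbb{C}^n\times\mathcal{M}_n:\ \det(Id+\Delta[(sz+tA.y)^2].A)=1\ \forall s,t\in\mathbb{C},\ z+A.(z^3+z*(A.y)^2)=0\}.$$ *)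

theory Defs
  imports "HOL-Analysis.Analysis"
begin

text \<open>
  On \<open>complex ^ 'n\<close> the library operations \<open>*\<close> and \<open>^\<close> are the coordinatewise product and
  power; scaling by a complex number is \<open>*s\<close>. On matrices \<open>*\<close> and \<open>^\<close> are again
  entrywise, so products and powers of matrices are written with \<open>**\<close>.
\<close>

definition Delta :: "complex ^ 'n \<Rightarrow> complex ^ 'n ^ 'n" where
  "Delta u = (\<chi> i j. if i = j then u $ i else 0)"

definition diagonal_matrix :: "complex ^ 'n ^ 'n \<Rightarrow> bool" where
  "diagonal_matrix D \<longleftrightarrow> (\<forall>i j. i \<noteq> j \<longrightarrow> D $ i $ j = 0)"

definition V_set :: "((complex ^ 'n) \<times> (complex ^ 'n) \<times> (complex ^ 'n ^ 'n)) set" where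
  "V_set = {(y, z, A).
     (\<forall>s t. det (mat 1 + Delta ((s *s z + t *s y) ^ 2) ** A) = 1) \<and>
     z + A *v (z ^ 3 + z * y ^ 2) = 0}"

definition W_set :: "((complex ^ 'n) \<times> (complex ^ 'n) \<times> (complex ^ 'n ^ 'n)) set" where
  "W_set = {(y, z, A).
     (\<forall>s t. det (mat 1 + Delta ((s *s z + t *s (A *v y)) ^ 2) ** A) = 1) \<and>
     z + A *v (z ^ 3 + z * (A *v y) ^ 2) = 0}"

end

theory Submission
  imports Defs
begin

text \<open>
  Coordinatewise multiplication commutes with diagonal matrices, so
  \<open>\<Delta>[(Dw)\<^sup>2] D = D\<^sup>3 \<Delta>[w\<^sup>2]\<close>; with \<open>A' = D A D\<^sup>-\<^sup>3\<close> this makes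
  \<open>Id + \<Delta>[(Dw)\<^sup>2] A'\<close> the conjugate of \<open>Id + \<Delta>[w\<^sup>2] A\<close> by \<open>D\<^sup>3\<close>. Likewise the cubic
  expression at \<open>(Dz, Dw)\<close> is \<open>D\<^sup>3\<close> times its value at \<open>(z, w)\<close>, and \<open>A'\<close> turns the
  factor \<open>D\<^sup>3\<close> into \<open>D\<close>. The case of \<open>W\<^sub>n\<close> is that of \<open>V\<^sub>n\<close> with \<open>A y\<close> in place of \<open>y\<close>,
  because \<open>A' D\<^sup>3 y = D A y\<close>.
\<close>

text \<open>This turns the action of diagonal matrices into the commutative coordinatewise product,
  so identities between them reduce to ring rewriting.\<close>

lemma Delta_mult_vector: "Delta u *v x = u * x"
  by (simp add: Delta_def matrix_vector_mult_def vec_eq_iff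
      if_distrib[of "\<lambda>a. a * _"] cong: if_cong)

lemma Delta_mult_Delta: "Delta u ** Delta v = Delta (u * v)"
  by (simp add: matrix_eq Delta_mult_vector mult.assoc flip: matrix_vector_mul_assoc)

lemma diagonal_matrix_imp_Delta:
  assumes "diagonal_matrix D"
  obtains d where "D = Delta d"
proof
  show "D = Delta (\<chi> i. D $ i $ i)"
    using assms by (auto simp: diagonal_matrix_def Delta_def vec_eq_iff)
qed

lemma invertible_matrix_inv:
  fixes C :: "'a::semiring_1 ^ 'n ^ 'm"
  assumes "invertible C"
  shows "C ** matrix_inv C = mat 1" and "matrix_inv C ** C = mat 1"
proof -
  have "C ** matrix_inv C = mat 1 \<and> matrix_inv C ** C = mat 1"
    using assms unfolding invertible_def matrix_inv_def by (rule someI_ex)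
  then show "C ** matrix_inv C = mat 1" and "matrix_inv C ** C = mat 1"
    by auto
qed

lemma matrix_add_rdistrib: "(A + B) ** C = A ** C + B ** C"
  by (vector matrix_matrix_mult_def sum.distrib distrib_right)

text \<open>The vector \<open>w\<close> is arbitrary in order to cover
  \<open>s *s z + t *s y\<close> as well as \<open>s *s z + t *s (A *v y)\<close>.\<close>

lemma det_conj_Delta:
  fixes A D :: "complex ^ 'n ^ 'n"
  assumes "diagonal_matrix D" "invertible D"
  shows "det (mat 1 + Delta ((D *v w) ^ 2) ** (D ** A ** matrix_inv (D ** D ** D)))
       = det (mat 1 + Delta (w ^ 2) ** A)"
proof -
  obtain d where d: "D = Delta d"
    using assms(1) by (rule diagonal_matrix_imp_Delta)
  define C where "C = D ** D ** D"
  have inv: "C ** matrix_inv C = mat 1"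
    unfolding C_def by (intro invertible_matrix_inv(1) invertible_mult assms)
  \<comment> \<open>Both sides are the diagonal matrix of \<open>d ^ 3 * w ^ 2\<close>.\<close>
  have "Delta ((D *v w) ^ 2) ** D = C ** Delta (w ^ 2)"
    by (simp add: C_def d Delta_mult_Delta Delta_mult_vector power2_eq_square mult_ac)
  then have "mat 1 + Delta ((D *v w) ^ 2) ** (D ** A ** matrix_inv C)
      = C ** (mat 1 + Delta (w ^ 2) ** A) ** matrix_inv C"
    by (simp add: matrix_add_ldistrib matrix_add_rdistrib matrix_mul_assoc inv)
  moreover have "det C * det (matrix_inv C) = 1"
    by (metis det_I det_mul inv)
  ultimately show ?thesis
    unfolding C_def[symmetric] by (simp add: det_mul mult_ac)
qed

text \<open>Here \<open>w\<close> stands for \<open>y\<close> or \<open>A *v y\<close>. With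
  \<open>D\<close> pulled out in front, vanishing at \<open>(z, w)\<close> carries over.\<close>

lemma cubic_map_conj:
  fixes A D :: "complex ^ 'n ^ 'n"
  assumes "diagonal_matrix D" "invertible D"
  shows "D *v z + (D ** A ** matrix_inv (D ** D ** D)) *v
           ((D *v z) ^ 3 + (D *v z) * (D *v w) ^ 2)
       = D *v (z + A *v (z ^ 3 + z * w ^ 2))"
proof -
  obtain d where d: "D = Delta d"
    using assms(1) by (rule diagonal_matrix_imp_Delta)
  define C where "C = D ** D ** D"
  have inv: "matrix_inv C ** C = mat 1"
    unfolding C_def by (intro invertible_matrix_inv(2) invertible_mult assms)
  have "(D *v z) ^ 3 + (D *v z) * (D *v w) ^ 2 = C *v (z ^ 3 + z * w ^ 2)"
    by (simp add: C_def d Delta_mult_Delta Delta_mult_vector power2_eq_square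
        power3_eq_cube algebra_simps)
  moreover have "(D ** A ** matrix_inv C) *v (C *v x) = D *v (A *v x)" for x
    by (metis inv matrix_mul_assoc matrix_mul_rid matrix_vector_mul_assoc)
  ultimately show ?thesis
    by (simp add: C_def matrix_vector_right_distrib)
qed

text \<open>By linearity the combination inside \<open>Delta\<close> gets the form
  \<open>D *v w\<close> that \<open>det_conj_Delta\<close> expects.\<close>

lemma matrix_vector_mult_combination:
  fixes D :: "complex ^ 'n ^ 'm"
  shows "s *s (D *v z) + t *s (D *v y) = D *v (s *s z + t *s y)"
  by (simp add: matrix_vector_right_distrib vector_scalar_commute)

theorem theorem1p9:
  shows "(\<forall>(y :: complex ^ 'n) z A D.
            (y, z, A) \<in> V_set \<and> diagonal_matrix D \<and> invertible D \<longrightarrow>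
            (D *v y, D *v z, D ** A ** matrix_inv (D ** D ** D)) \<in> V_set) \<and>
         (\<forall>(y :: complex ^ 'n) z A D.
            (y, z, A) \<in> W_set \<and> diagonal_matrix D \<and> invertible D \<longrightarrow>
            ((D ** D ** D) *v y, D *v z, D ** A ** matrix_inv (D ** D ** D)) \<in> W_set)"
proof (intro conjI allI impI; elim conjE)
  fix y z :: "complex ^ 'n" and A D :: "complex ^ 'n ^ 'n"
  assume "(y, z, A) \<in> V_set" "diagonal_matrix D" "invertible D"
  then show "(D *v y, D *v z, D ** A ** matrix_inv (D ** D ** D)) \<in> V_set"
    by (simp add: V_set_def matrix_vector_mult_combination det_conj_Delta cubic_map_conj)
next
  fix y z :: "complex ^ 'n" and A D :: "complex ^ 'n ^ 'n"
  assume W: "(y, z, A) \<in> W_set" and D: "diagonal_matrix D" "invertible D"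
  have "matrix_inv (D ** D ** D) ** (D ** D ** D) = mat 1"
    by (intro invertible_matrix_inv(2) invertible_mult D)
  then have "(D ** A ** matrix_inv (D ** D ** D)) *v ((D ** D ** D) *v y) = D *v (A *v y)"
    by (metis matrix_mul_assoc matrix_mul_rid matrix_vector_mul_assoc)
  with W D show "((D ** D ** D) *v y, D *v z, D ** A ** matrix_inv (D ** D ** D)) \<in> W_set"
    by (simp only: W_set_def mem_Collect_eq case_prod_conv matrix_vector_mult_combination
        det_conj_Delta cubic_map_conj) simp
qed

end
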